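(* Let $P=3\times5\times\dots\times331$ be the product of all odd primes $p$ with $3\le p\le 331$. Let $m$ be an odd integer with $1\le m<P^2$. Then for every even integer of the form $n=2^{\alpha}m$ with $\alpha\ge1$ an integer and $n\ge 2P^2$, both $$\sigma(n)\le H_n+\exp(H_n)\log(H_n)\qquad\text{and}\qquad \sigma(n)<e^{\gamma}n\log\log n$$ hold.
   Context: $\sigma(n)=\sum_{d\mid n} d$ is the sum-of-divisors function, $H_n=\sum_{j=1}^n \frac1j$ is the $n$-th harmonic number, $\gamma$ is the Euler–Mascheroni constant, and $\log$ is the natural logarithm. The first inequality is the paper's "Lagarias criterion" for $n$, the second is "Robin's criterion" for $n$. The set of all $n=2^\alpha m\ge N$ with $\alpha\ge 1$, for fixed odd $m$ and fixed even $N$ (here $N=2P^2$), is what the paper calls the odd integer class number set of $m$. *)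

theory Defs
  imports "HOL-Analysis.Analysis" "HOL-Computational_Algebra.Primes"
begin

text \<open>For \<open>n = 0\<close> the index set is infinite, so \<open>sigma 0 = 0\<close>; only positive arguments matter.\<close>

definition sigma :: "nat \<Rightarrow> nat" where
  "sigma n = (\<Sum>d | d dvd n. d)"

definition lagarias_criterion :: "nat \<Rightarrow> bool" where
  "lagarias_criterion n \<longleftrightarrow>
     real (sigma n) \<le> harm n + exp (harm n) * ln (harm n)"

definition robin_criterion :: "nat \<Rightarrow> bool" where
  "robin_criterion n \<longleftrightarrow>
     real (sigma n) < exp euler_mascheroni * real n * ln (ln (real n))"

definition oddPrimeProduct :: nat where
  "oddPrimeProduct = \<Prod>{p. prime p \<and> 3 \<le> p \<and> p \<le> 331}"

end

theory Submission
  imports Defs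
begin

text \<open>Since \<open>sigma (2 ^ \<alpha>) / 2 ^ \<alpha> < 2\<close>, it suffices to bound \<open>sigma m / m\<close> for odd \<open>m < P\<^sup>2\<close>. As
  for colossally abundant numbers, fix a multiplier \<open>\<lambda>\<close> and choose the odd number
  \<open>M = \<Prod>p ^ e p\<close> that maximizes \<open>ln (sigma M / M) - \<lambda> ln M\<close>, which can be done prime by prime.
  If \<open>M \<ge> P\<^sup>2\<close>, then \<open>sigma m / m \<le> sigma M / M\<close>, because the penalty for \<open>m < M\<close> is smaller.
  With \<open>\<lambda>\<close> chosen so that the primes up to 607 occur in \<open>M\<close>, one gets
  \<open>2 * sigma M / M < 11.394 < 1.778 * 6.41\<close>, where \<open>1.778\<close> bounds \<open>exp \<gamma>\<close> and \<open>6.41\<close> bounds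
  \<open>ln (ln (2 * P\<^sup>2))\<close> from below. This is Robin's inequality, and it implies that of Lagarias because
  \<open>H\<^sub>n \<ge> ln n + \<gamma>\<close>.\<close>


section \<open>Submultiplicativity of the divisor sum\<close>

text \<open>Every divisor of \<open>a * b\<close> splits as \<open>x * y\<close> with
  \<open>x dvd a\<close> and \<open>y dvd b\<close>. Different pairs may give the same product,
  hence only an inequality.\<close>

lemma sigma_mult_le:
  assumes "a > 0" "b > 0"
  shows "sigma (a * b) \<le> sigma a * sigma b"
proof -
  let ?I = "{d. d dvd a} \<times> {d. d dvd b}"
  have fin: "finite ?I" using assms by simp
  have sub: "{d. d dvd a * b} \<subseteq> (\<lambda>(x, y). x * y) ` ?I"
  proof
    fix d assume "d \<in> {d. d dvd a * b}"
    then obtain x y where "d = x * y" "x dvd a" "y dvd b"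
      using division_decomp[of d a b] by auto
    then show "d \<in> (\<lambda>(x, y). x * y) ` ?I" by (auto intro!: image_eqI[of _ _ "(x, y)"])
  qed
  have "sigma (a * b) \<le> (\<Sum>d \<in> (\<lambda>(x, y). x * y) ` ?I. d)"
    unfolding sigma_def by (rule sum_mono2) (use fin sub in auto)
  also have "\<dots> \<le> (\<Sum>(x, y) \<in> ?I. x * y)"
    using sum_image_le[OF fin, of "\<lambda>d. d" "\<lambda>(x, y). x * y"]
    by (simp add: o_def case_prod_unfold)
  also have "\<dots> = sigma a * sigma b"
    unfolding sigma_def by (simp add: sum_product sum.cartesian_product)
  finally show ?thesis .
qed

lemma sigma_prod_le:
  assumes "finite A" "\<And>x. x \<in> A \<Longrightarrow> f x > 0"
  shows "sigma (prod f A) \<le> (\<Prod>x\<in>A. sigma (f x))"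
  using assms
proof (induction A rule: finite_induct)
  case empty
  have "{d::nat. d dvd 1} = {1}" by auto
  then show ?case by (simp add: sigma_def)
next
  case (insert x A)
  have "sigma (f x * prod f A) \<le> sigma (f x) * sigma (prod f A)"
    using insert by (intro sigma_mult_le) (auto intro!: prod_pos)
  also have "\<dots> \<le> sigma (f x) * (\<Prod>x\<in>A. sigma (f x))"
    using insert by (intro mult_left_mono) auto
  finally show ?case using insert by simp
qed

definition geom_sum :: "nat \<Rightarrow> nat \<Rightarrow> nat" where
  "geom_sum p k = (\<Sum>i\<le>k. p ^ i)"

lemma geom_sum_0 [simp]: "geom_sum p 0 = 1"
  by (simp add: geom_sum_def)

text \<open>Horner form: it evaluates the sum at numerals and yields the increments of
  \<open>ratio\<close>.\<close>

lemma geom_sum_Suc: "geom_sum p (Suc k) = 1 + p * geom_sum p k"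
  unfolding geom_sum_def sum.atMost_Suc_shift by (simp add: sum_distrib_left)

lemma geom_sum_1 [simp]: "geom_sum p (Suc 0) = 1 + p"
  by (simp add: geom_sum_Suc)

lemma geom_sum_numeral [simp]:
  "geom_sum p (numeral k) = 1 + p * geom_sum p (pred_numeral k)"
  by (simp add: numeral_eq_Suc geom_sum_Suc)

lemma geom_sum_pos [simp]: "geom_sum p k > 0"
  by (induction k) (simp_all add: geom_sum_Suc)

lemma geom_sum_mono:
  assumes "p \<ge> 1" "j \<le> k"
  shows "geom_sum p j \<le> geom_sum p k"
  unfolding geom_sum_def using assms by (intro sum_mono2) auto

lemma sigma_prime_power:
  assumes "prime p"
  shows "sigma (p ^ k) = geom_sum p k"
proof -
  have "{d. d dvd p ^ k} = (\<lambda>i. p ^ i) ` {..k}"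
    using assms by (auto simp: divides_primepow_nat)
  moreover have "inj_on (\<lambda>i. p ^ i) {..k}"
    using prime_gt_1_nat[OF assms] by (auto intro!: inj_onI)
  ultimately show ?thesis by (simp add: sigma_def geom_sum_def sum.reindex)
qed

section \<open>Comparison with a colossally abundant number\<close>

text \<open>For prime \<open>p\<close> this is sigma(q)/q at q = \<open>p ^ k\<close>.\<close>

definition ratio :: "nat \<Rightarrow> nat \<Rightarrow> real" where
  "ratio p k = real (geom_sum p k) / real p ^ k"

lemma ratio_0 [simp]: "ratio p 0 = 1"
  by (simp add: ratio_def)

lemma ratio_pos: "p > 0 \<Longrightarrow> ratio p k > 0"
  by (simp add: ratio_def)

text \<open>Dividing the Horner recursion by \<open>p ^ Suc k\<close> multiplies the ratio by 1 +
  1/(\<open>p * geom_sum p k\<close>).\<close>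

lemma ln_ratio_Suc:
  assumes "p > 0"
  shows "ln (ratio p (Suc k)) = ln (ratio p k) + ln (1 + 1 / real (p * geom_sum p k))"
proof -
  have "real (geom_sum p k) > 0" by simp
  then have "ratio p (Suc k) = ratio p k * (1 + 1 / real (p * geom_sum p k))"
    using assms by (simp add: ratio_def geom_sum_Suc field_simps)
  moreover have "1 + 1 / real (p * geom_sum p k) > 0"
    by (intro add_pos_nonneg) auto
  ultimately show ?thesis
    using ratio_pos[OF assms, of k] by (simp add: ln_mult_pos)
qed

text \<open>The increments of \<^term>\<open>\<lambda>k. ln (ratio p k)\<close> decrease in \<open>k\<close>, so this is the tangent
  inequality of a concave sequence at \<open>e\<close>.\<close>

lemma ln_ratio_le_tangent:
  assumes p: "p > 0"
    and up: "e > 0 \<Longrightarrow> L \<le> ln (1 + 1 / real (p * geom_sum p (e - 1)))"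
    and low: "ln (1 + 1 / real (p * geom_sum p e)) \<le> L"
  shows "ln (ratio p a) \<le> ln (ratio p e) + (real a - real e) * L"
proof -
  have anti: "ln (1 + 1 / real (p * geom_sum p k)) \<le> ln (1 + 1 / real (p * geom_sum p j))"
    if "j \<le> k" for j k
  proof -
    have "real (p * geom_sum p j) \<le> real (p * geom_sum p k)"
      using geom_sum_mono[of p j k] p that by simp
    then have "1 / real (p * geom_sum p k) \<le> 1 / real (p * geom_sum p j)"
      using p by (intro divide_left_mono mult_pos_pos) (auto simp flip: of_nat_mult)
    then show ?thesis by (subst ln_le_cancel_iff) (auto intro!: add_pos_nonneg)
  qed
  show ?thesis
  proof (cases "e \<le> a")
    case True
    then show ?thesis
    proof (induction a rule: dec_induct)
      case (step k)
      have "ln (1 + 1 / real (p * geom_sum p k)) \<le> L"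
        using anti[of e k] low step.hyps by simp
      then show ?case using step.IH ln_ratio_Suc[OF p, of k] by (simp add: algebra_simps)
    qed simp
  next
    case False
    then have "a \<le> e" by simp
    then show ?thesis
    proof (induction a rule: inc_induct)
      case (step k)
      have "L \<le> ln (1 + 1 / real (p * geom_sum p k))"
        using anti[of k "e - 1"] up step.hyps by (force intro: order_trans)
      then show ?case using step.IH ln_ratio_Suc[OF p, of k] by (simp add: algebra_simps)
    qed simp
  qed
qed

text \<open>Weighing an exponent of \<open>p\<close> with \<open>\<lambda> ln p\<close>, the weighted excess of \<open>m\<close> over
  \<open>\<Prod>p\<in>T. p ^ e p\<close> is \<open>\<lambda>\<close> times the logarithm of their quotient, hence nonpositive.\<close>

lemma sigma_le_of_tangent:
  assumes m: "m > 0" and T: "finite T" "\<And>p. p \<in> T \<Longrightarrow> prime p"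
    and e0: "\<And>p. p \<in> prime_factors m - T \<Longrightarrow> e p = 0"
    and lam: "lam \<ge> 0"
    and tangent: "\<And>p a. p \<in> T \<union> prime_factors m \<Longrightarrow>
      ln (ratio p a) \<le> ln (ratio p (e p)) + (real a - real (e p)) * (lam * ln (real p))"
    and M: "m \<le> (\<Prod>p\<in>T. p ^ e p)"
  shows "real (sigma m) \<le> real m * (\<Prod>p\<in>T. ratio p (e p))"
proof -
  \<comment> \<open>Both \<open>m\<close> and the comparison number become products over
    \<open>S\<close>, with exponent 0 at the added primes.\<close>
  define S where "S = T \<union> prime_factors m"
  define v where "v p = multiplicity p m" for p
  have S: "finite S" using T by (simp add: S_def)
  have pS: "prime p" if "p \<in> S" for p
    using that T by (auto simp: S_def)
  have pos: "p > 0" if "p \<in> S" for p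
    using pS[OF that] prime_gt_0_nat by blast
  have v0: "v p = 0" if "p \<in> S" "p \<notin> prime_factors m" for p
    using that pS[of p] m unfolding v_def
    by (intro not_dvd_imp_multiplicity_0) (auto simp: in_prime_factors_iff)
  have m_eq: "m = (\<Prod>p\<in>prime_factors m. p ^ v p)"
    unfolding v_def using m by (rule prime_factorization_nat)
  also have "\<dots> = (\<Prod>p\<in>S. p ^ v p)"
    by (rule prod.mono_neutral_left) (use S v0 in \<open>auto simp: S_def\<close>)
  finally have m_S: "m = (\<Prod>p\<in>S. p ^ v p)" .
  have M_S: "(\<Prod>p\<in>T. p ^ e p) = (\<Prod>p\<in>S. p ^ e p)"
    by (rule prod.mono_neutral_left) (use S e0 in \<open>auto simp: S_def\<close>)
  have R_S: "(\<Prod>p\<in>T. ratio p (e p)) = (\<Prod>p\<in>S. ratio p (e p))"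
    by (rule prod.mono_neutral_left) (use S e0 in \<open>auto simp: S_def\<close>)
  have ln_prod_S: "ln (real (\<Prod>p\<in>S. p ^ f p)) = (\<Sum>p\<in>S. real (f p) * ln (real p))" for f
    unfolding of_nat_prod using S pos by (subst ln_prod) (auto simp: ln_realpow intro!: sum.cong)
  have "ln (\<Prod>p\<in>S. ratio p (v p)) = (\<Sum>p\<in>S. ln (ratio p (v p)))"
    using S ratio_pos pos by (intro ln_prod) (auto simp: less_imp_neq[symmetric])
  also have "\<dots> \<le> (\<Sum>p\<in>S. ln (ratio p (e p)) + (real (v p) - real (e p)) * (lam * ln (real p)))"
    by (intro sum_mono tangent) (simp add: S_def)
  also have "\<dots> = (\<Sum>p\<in>S. ln (ratio p (e p)))
      + lam * ((\<Sum>p\<in>S. real (v p) * ln (real p)) - (\<Sum>p\<in>S. real (e p) * ln (real p)))"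
    by (simp add: sum.distrib sum_subtractf sum_distrib_left algebra_simps)
  also have "\<dots> \<le> (\<Sum>p\<in>S. ln (ratio p (e p))) + 0"
  proof (intro add_left_mono mult_nonneg_nonpos lam)
    have "ln (real m) \<le> ln (real (\<Prod>p\<in>S. p ^ e p))"
      using m M unfolding M_S
      by (subst ln_le_cancel_iff) (auto simp del: of_nat_prod simp: of_nat_le_iff dest: order.strict_trans2)
    then show "(\<Sum>p\<in>S. real (v p) * ln (real p)) - (\<Sum>p\<in>S. real (e p) * ln (real p)) \<le> 0"
      using ln_prod_S[of v] ln_prod_S[of e] m_S by simp
  qed
  also have "(\<Sum>p\<in>S. ln (ratio p (e p))) + 0 = ln (\<Prod>p\<in>S. ratio p (e p))"
    using S ratio_pos pos by (subst ln_prod) (auto simp: less_imp_neq[symmetric])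
  finally have le: "(\<Prod>p\<in>S. ratio p (v p)) \<le> (\<Prod>p\<in>S. ratio p (e p))"
    using ratio_pos pos by (subst (asm) ln_le_cancel_iff) (auto intro!: prod_pos)
  have "sigma m \<le> (\<Prod>p\<in>S. sigma (p ^ v p))"
    using sigma_prod_le[OF S, of "\<lambda>p. p ^ v p"] pos m_S by simp
  also have "\<dots> = (\<Prod>p\<in>S. geom_sum p (v p))"
    using pS by (intro prod.cong) (auto simp: sigma_prime_power)
  finally have "real (sigma m) \<le> (\<Prod>p\<in>S. real (geom_sum p (v p)))"
    by (simp flip: of_nat_prod)
  also have "\<dots> = (\<Prod>p\<in>S. real (p ^ v p) * ratio p (v p))"
    using pos by (intro prod.cong) (auto simp: ratio_def)
  also have "\<dots> = real m * (\<Prod>p\<in>S. ratio p (v p))"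
    by (subst m_S) (simp add: prod.distrib)
  also have "\<dots> \<le> real m * (\<Prod>p\<in>S. ratio p (e p))"
    using le by (intro mult_left_mono) auto
  finally show ?thesis using R_S by simp
qed

text \<open>The parameter for which raising the exponent of \<open>y\<close> from \<open>0\<close> to \<open>1\<close> is exactly neutral.\<close>

definition lagrange :: "real \<Rightarrow> real" where
  "lagrange y = ln (1 + 1 / y) / ln y"

lemma lagrange_nonneg: "y > 1 \<Longrightarrow> lagrange y \<ge> 0"
  by (simp add: lagrange_def)

text \<open>In the next two lemmas \<open>u / v\<close> approximates \<open>ln p / ln y\<close>, which turns comparisons of
  logarithms into comparisons of integers.\<close>

lemma lagrange_le:
  fixes p y D u v :: nat
  assumes "y > 1" "p > 0" "D > 0" "v > 0"
    and pv: "p ^ v \<le> y ^ u" and D: "(y + 1) ^ u * D ^ v \<le> y ^ u * (D + 1) ^ v"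
  shows "lagrange y * ln p \<le> ln (1 + 1 / D)"
proof -
  have "ln (real p ^ v) \<le> ln (real y ^ u)"
    using assms by (subst ln_le_cancel_iff) (auto simp flip: of_nat_power)
  then have 1: "real v * ln p \<le> real u * ln y"
    using assms by (simp add: ln_realpow)
  have "real ((y + 1) ^ u * D ^ v) \<le> real (y ^ u * (D + 1) ^ v)"
    using D by (simp only: of_nat_le_iff)
  then have "((y + 1) / y) ^ u \<le> ((D + 1) / D) ^ v"
    using assms by (simp add: power_divide field_simps)
  then have "ln ((1 + 1 / y) ^ u) \<le> ln ((1 + 1 / D) ^ v)"
    using assms by (subst ln_le_cancel_iff) (auto simp: field_simps add_pos_pos)
  then have 2: "real u * ln (1 + 1 / y) \<le> real v * ln (1 + 1 / D)"
    using assms by (simp add: ln_realpow add_pos_pos)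
  have "real v * (lagrange y * ln p) \<le> lagrange y * (real u * ln y)"
    using mult_left_mono[OF 1 lagrange_nonneg[of y]] assms by (simp add: mult_ac)
  also have "\<dots> = real u * ln (1 + 1 / y)"
    using assms by (simp add: lagrange_def)
  finally show ?thesis using 2 assms by (smt (verit) mult_le_cancel_left_pos of_nat_0_less_iff)
qed

lemma lagrange_ge:
  fixes p y D u v :: nat
  assumes "y > 1" "p > 0" "D > 0" "v > 0"
    and pv: "y ^ u \<le> p ^ v" and D: "y ^ u * (D + 1) ^ v \<le> (y + 1) ^ u * D ^ v"
  shows "ln (1 + 1 / D) \<le> lagrange y * ln p"
proof -
  have "ln (real y ^ u) \<le> ln (real p ^ v)"
    using assms by (subst ln_le_cancel_iff) (auto simp flip: of_nat_power)
  then have 1: "real u * ln y \<le> real v * ln p"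
    using assms by (simp add: ln_realpow)
  have "real (y ^ u * (D + 1) ^ v) \<le> real ((y + 1) ^ u * D ^ v)"
    using D by (simp only: of_nat_le_iff)
  then have "((D + 1) / D) ^ v \<le> ((y + 1) / y) ^ u"
    using assms by (simp add: power_divide field_simps)
  then have "ln ((1 + 1 / D) ^ v) \<le> ln ((1 + 1 / y) ^ u)"
    using assms by (subst ln_le_cancel_iff) (auto simp: field_simps add_pos_pos)
  then have 2: "real v * ln (1 + 1 / D) \<le> real u * ln (1 + 1 / y)"
    using assms by (simp add: ln_realpow add_pos_pos)
  have "real u * ln (1 + 1 / y) = lagrange y * (real u * ln y)"
    using assms by (simp add: lagrange_def)
  also have "\<dots> \<le> real v * (lagrange y * ln p)"
    using mult_left_mono[OF 1 lagrange_nonneg[of y]] assms by (simp add: mult_ac)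
  finally show ?thesis using 2 assms by (smt (verit) mult_le_cancel_left_pos of_nat_0_less_iff)
qed

section \<open>The comparison number for \<open>y = 607\<close>\<close>

text \<open>\<open>expo p\<close> is the exponent of \<open>p\<close> in the odd number \<open>N\<close> that maximizes
  \<open>sigma N / N powr (1 + lagrange 607)\<close>.\<close>

definition expo :: "nat \<Rightarrow> nat" where
  "expo p = (if p = 3 then 7 else if p = 5 then 4 else if p \<le> 11 then 3
     else if p \<le> 31 then 2 else if p \<le> 607 then 1 else 0)"

section \<open>Enumeration of the odd primes up to 607\<close>

lemma prime_iff_no_small_prime_factor:
  fixes n b :: nat
  assumes "1 < n" "n < b\<^sup>2"
  shows "prime n \<longleftrightarrow> (\<forall>q. prime q \<and> q < b \<longrightarrow> \<not> q dvd n \<or> n = q)"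
proof
  assume "prime n"
  then show "\<forall>q. prime q \<and> q < b \<longrightarrow> \<not> q dvd n \<or> n = q"
    using primes_dvd_imp_eq by blast
next
  assume small: "\<forall>q. prime q \<and> q < b \<longrightarrow> \<not> q dvd n \<or> n = q"
  show "prime n"
  proof (rule ccontr)
    assume "\<not> prime n"
    then obtain c where c: "c dvd n" "c \<noteq> 1" "c \<noteq> n"
      using assms(1) by (auto simp: prime_nat_iff)
    then obtain d where d: "n = c * d" by auto
    \<comment> \<open>The smaller of two complementary divisors satisfies
      \<open>e * e \<le> n < b\<^sup>2\<close>, so its prime factors lie below
      \<open>b\<close>.\<close>
    define e where "e = min c d"
    have e: "e dvd n" "e \<noteq> 1" "e \<noteq> n" "e * e \<le> n"
      using c d assms(1) by (auto simp: e_def min_def intro: gr0I)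
    have "e < b"
      using e(4) assms(2)
      by (metis less_le_trans linorder_not_le mult_le_mono order_trans power2_eq_square)
    obtain q where q: "prime q" "q dvd e" using e(2) prime_factor_nat by blast
    have "e > 0" using e(1) assms(1) by (auto intro!: gr0I)
    then have "q \<le> e" using q(2) by (rule dvd_imp_le[rotated])
    moreover have "q dvd n" using q(2) e(1) by (rule dvd_trans)
    ultimately have "n = q" using small q \<open>e < b\<close> by auto
    then have "n = e" using q(2) e(1) by (simp add: dvd_antisym)
    then show False using e(3) by simp
  qed
qed

definition odds :: "nat \<Rightarrow> nat \<Rightarrow> nat list" where
  "odds a k = map (\<lambda>i. a + 2 * i) [0..<k]"

text \<open>Filtering and generating in one pass keeps the terms of the simplifier small: it never
  sees the unfiltered list.\<close>

lemma filter_odds_0: "filter P (odds a 0) = []"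
  by (simp add: odds_def)

lemma filter_odds_Suc:
  "filter P (odds a (Suc k)) =
    (if P a then a # filter P (odds (a + 2) k) else filter P (odds (a + 2) k))"
  by (simp add: odds_def upt_conv_Cons map_Suc_upt [symmetric] o_def del: upt_Suc)

lemma filter_odds_numeral:
  "filter P (odds a (numeral k)) =
    (if P a then a # filter P (odds (a + 2) (pred_numeral k))
     else filter P (odds (a + 2) (pred_numeral k)))"
  by (simp add: numeral_eq_Suc filter_odds_Suc)

text \<open>Trial division by the odd primes below 25 suffices for odd \<open>n\<close> with 1 <
  \<open>n\<close> < 625.\<close>

definition no_small_factor :: "nat \<Rightarrow> bool" where
  "no_small_factor n \<longleftrightarrow> (\<forall>q\<in>{3,5,7,11,13,17,19,23}. \<not> q dvd n \<or> n = q)"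

text \<open>The 303 odd numbers starting at 3 end exactly at 607.\<close>

definition odd_primes :: "nat list" where
  "odd_primes = filter prime (odds 3 303)"

lemma primes_less_25: "prime q \<and> q < 25 \<longleftrightarrow> q \<in> {2,3,5,7,11,13,17,19,23::nat}"
proof -
  have "{2..<25} = set [2..<25::nat]" by (rule set_upt [symmetric])
  also have "[2..<25::nat] = [2,3,4,5,6,7,8,9,10,11,12,13,14,15,16,17,18,19,20,21,22,23,24]"
    by (simp add: upt_rec_numeral)
  finally have upto_24: "{2..<25} =
      set [2,3,4,5,6,7,8,9,10,11,12,13,14,15,16,17,18,19,20,21,22,23,24::nat]" .
  have "q \<in> {2,3,5,7,11,13,17,19,23}" if "prime q" "q \<in> {2..<25}"
    using that(2,1) unfolding upto_24 list.set by (elim insertE emptyE; hypsubst; simp)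
  moreover have "prime q \<and> q < 25" if "q \<in> {2,3,5,7,11,13,17,19,23}"
    using that by (elim insertE emptyE; hypsubst; simp)
  ultimately show ?thesis using prime_ge_2_nat[of q] by (metis atLeastLessThan_iff)
qed

lemma odd_primes_eq:
  "odd_primes =
      [3, 5, 7, 11, 13, 17, 19, 23, 29, 31, 37, 41, 43, 47, 53, 59, 61, 67, 71, 73, 79, 83, 89,
      97, 101, 103, 107, 109, 113, 127, 131, 137, 139, 149, 151, 157, 163, 167, 173, 179, 181,
      191, 193, 197, 199, 211, 223, 227, 229, 233, 239, 241, 251, 257, 263, 269, 271, 277, 281,
      283, 293, 307, 311, 313, 317, 331, 337, 347, 349, 353, 359, 367, 373, 379, 383, 389, 397,
      401, 409, 419, 421, 431, 433, 439, 443, 449, 457, 461, 463, 467, 479, 487, 491, 499, 503,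
      509, 521, 523, 541, 547, 557, 563, 569, 571, 577, 587, 593, 599, 601, 607]"
proof -
  have "prime n \<longleftrightarrow> no_small_factor n" if n: "n \<in> set (odds 3 303)" for n
  proof -
    obtain i where i: "n = 2 * i + 3" "i < 303"
      using n by (auto simp: odds_def)
    then have n': "1 < n" "n < 25\<^sup>2" "\<not> 2 dvd n" by auto
    have "prime n \<longleftrightarrow> (\<forall>q\<in>{2,3,5,7,11,13,17,19,23}. \<not> q dvd n \<or> n = q)"
      unfolding prime_iff_no_small_prime_factor[OF n'(1,2)] primes_less_25 by blast
    then show ?thesis using n'(3) by (simp add: no_small_factor_def)
  qed
  then have "odd_primes = filter no_small_factor (odds 3 303)"
    unfolding odd_primes_def by (intro filter_cong) auto
  then show ?thesis
    by (simp add: no_small_factor_def filter_odds_numeral filter_odds_Suc filter_odds_0)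
qed

lemma set_odd_primes: "set odd_primes = {p::nat. prime p \<and> 3 \<le> p \<and> p \<le> 607}"
proof (intro equalityI subsetI CollectI)
  fix p assume "p \<in> {p::nat. prime p \<and> 3 \<le> p \<and> p \<le> 607}"
  then have p: "prime p" "3 \<le> p" "p \<le> 607" by auto
  then have "odd p" using prime_odd_nat by auto
  then obtain j where "p = 2 * j + 1" by (elim oddE)
  then have "p = 3 + 2 * (j - 1)" "j - 1 < 303" using p by auto
  then show "p \<in> set odd_primes" using p(1) by (auto simp: odd_primes_def odds_def)
qed (auto simp: odd_primes_def odds_def)

lemma distinct_odd_primes: "distinct odd_primes"
  by (simp add: odd_primes_def odds_def distinct_map inj_on_def)

lemma prod_odd_primes: "(\<Prod>p\<in>set odd_primes. f p) = prod_list (map f odd_primes)"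
  by (simp add: prod.distinct_set_conv_list distinct_odd_primes)

lemma oddPrimeProduct_eq: "oddPrimeProduct = prod_list (filter (\<lambda>p. p \<le> 331) odd_primes)"
proof -
  have "{p. prime p \<and> 3 \<le> p \<and> p \<le> 331} = set (filter (\<lambda>p. p \<le> 331) odd_primes)"
    by (auto simp: set_odd_primes)
  then show ?thesis
    unfolding oddPrimeProduct_def
    by (simp add: prod.distinct_set_conv_list distinct_odd_primes del: set_filter)
qed

text \<open>Optimality of \<open>expo p\<close>: the last factor \<open>p\<close> gains at least its
  price \<open>lagrange 607 * ln p\<close>, and one more would gain at most that. These are the
  hypotheses of \<open>ln_ratio_le_tangent\<close>.\<close>

lemma lagrange_expo:
  assumes p: "prime p" "3 \<le> p"
  shows "(expo p > 0 \<longrightarrow> lagrange 607 * ln p \<le> ln (1 + 1 / real (p * geom_sum p (expo p - 1))))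
    \<and> ln (1 + 1 / real (p * geom_sum p (expo p))) \<le> lagrange 607 * ln p"
proof -
  consider "p \<in> {3,5,7,11,13,17,19,23,29,31}" | "37 \<le> p" "p \<le> 607" | "p > 607"
  proof -
    have "p \<in> {3,5,7,11,13,17,19,23,29,31}" if "p < 37"
    proof -
      have "p \<in> set odd_primes" using p that by (simp add: set_odd_primes)
      then show ?thesis using that unfolding odd_primes_eq by auto
    qed
    then show ?thesis using that by force
  qed
  then show ?thesis
  proof cases
    case 1
    note up = lagrange_le[of 607 p "p * geom_sum p (expo p - 1)", unfolded of_nat_numeral]
    note low = lagrange_ge[of 607 p "p * geom_sum p (expo p)", unfolded of_nat_numeral]
    from 1 show ?thesis
    \<comment> \<open>In each case \<open>u / v\<close> bounds ln p / ln 607 from above in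
      \<open>up\<close> and from below in \<open>low\<close>.\<close>
    proof (elim insertE emptyE)
      assume "p = 3" then show ?thesis
        using up[where u = 2 and v = 11] low[where u = 1 and v = 6] by (simp add: expo_def)
    next
      assume "p = 5" then show ?thesis
        using up[where u = 1 and v = 2] low[where u = 1 and v = 4] by (simp add: expo_def)
    next
      assume "p = 7" then show ?thesis
        using up[where u = 1 and v = 1] low[where u = 1 and v = 4] by (simp add: expo_def)
    next
      assume "p = 11" then show ?thesis
        using up[where u = 2 and v = 5] low[where u = 1 and v = 3] by (simp add: expo_def)
    next
      assume "p = 29" then show ?thesis
        using up[where u = 2 and v = 3] low[where u = 1 and v = 2] by (simp add: expo_def)
    next
      assume "p = 31" then show ?thesis
        using up[where u = 3 and v = 5] low[where u = 1 and v = 2] by (simp add: expo_def)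
    \<comment> \<open>The remaining primes are 13, 17, 19 and 23.\<close>
    qed (use up[where u = 1 and v = 1] low[where u = 1 and v = 3] in \<open>simp_all add: expo_def\<close>)
  next
    case 2
    have "lagrange 607 * ln p \<le> ln (1 + 1 / p)"
      using lagrange_le[of 607 p p 1 1] 2 by simp
    moreover have "ln (1 + 1 / real (p * (p + 1))) \<le> lagrange 607 * ln p"
    proof -
      define D where "D = p * (p + 1)"
      have D: "37 * 38 \<le> D" unfolding D_def using 2 by (intro mult_mono) auto
      \<comment> \<open>With \<open>v = 2\<close> and \<open>u = 1\<close>,
        \<open>lagrange_ge\<close> requires 607(D+1)^2 \<le> 608 D^2, which is
        \<open>607 * (2 * D + 1) \<le> D * D\<close>. The bound 1406 = 37 * 38 makes this uniform in
        \<open>p\<close>.\<close>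
      then have "607 * (2 * D + 1) \<le> 1406 * D" by simp
      also have "\<dots> \<le> D * D" using D by (intro mult_le_mono1) simp
      finally have "607 * (2 * D + 1) \<le> D * D" .
      moreover have "37 * 37 \<le> p * p" using 2 by (intro mult_mono) auto
      ultimately have "ln (1 + 1 / real D) \<le> lagrange 607 * ln p"
        using lagrange_ge[of 607 p D 2 1] D 2 by (simp add: power2_eq_square algebra_simps)
      then show ?thesis by (simp add: D_def)
    qed
    moreover have "expo p = 1" "geom_sum p (Suc 0) = p + 1"
      using 2 by (simp_all add: expo_def geom_sum_Suc)
    ultimately show ?thesis by simp
  next
    case 3
    then show ?thesis
      using lagrange_ge[of 607 p p 1 1] by (simp add: expo_def)
  qed
qed

section \<open>Numerical size and divisor ratio of the comparison number\<close>

text \<open>The lower bound gives n \<ge> 2^881; the upper one keeps P^2 within 2^882, which the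
  comparison number reaches.\<close>

lemma oddPrimeProduct_bounds: "2 ^ 440 \<le> oddPrimeProduct" "oddPrimeProduct \<le> 2 ^ 441"
  unfolding oddPrimeProduct_eq odd_primes_eq by simp_all

lemma prod_power_expo_ge: "2 ^ 882 \<le> (\<Prod>p\<in>set odd_primes. p ^ expo p)"
  unfolding prod_odd_primes odd_primes_eq by (simp add: expo_def)

lemma oddPrimeProduct_squared_le: "oddPrimeProduct\<^sup>2 \<le> (\<Prod>p\<in>set odd_primes. p ^ expo p)"
proof -
  have "oddPrimeProduct\<^sup>2 \<le> (2 ^ 441)\<^sup>2"
    using oddPrimeProduct_bounds(2) by (intro power_mono) auto
  also have "\<dots> = 2 ^ 882" by (simp only: power_mult [symmetric]) simp
  also note prod_power_expo_ge
  finally show ?thesis .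
qed

text \<open>Multiplies \<open>x\<close> by the ratios \<open>geom_sum p (expo p) / p ^ expo p\<close>, rounding up at each step, so
  that a fixed-point value of the product is computed with small numerals only.\<close>

fun mult_ratios :: "nat list \<Rightarrow> nat \<Rightarrow> nat" where
  "mult_ratios [] x = x"
| "mult_ratios (p # ps) x = mult_ratios ps (x * geom_sum p (expo p) div p ^ expo p + 1)"

lemma mult_ratios_ge:
  assumes "0 \<notin> set ps"
  shows "real x * prod_list (map (\<lambda>p. ratio p (expo p)) ps) \<le> real (mult_ratios ps x)"
  using assms
proof (induction ps arbitrary: x)
  case (Cons p ps)
  let ?r = "\<lambda>p. ratio p (expo p)"
  define q where "q = x * geom_sum p (expo p) div p ^ expo p"
  have p: "p ^ expo p > 0" using Cons.prems by simp
  have "x * geom_sum p (expo p) < (q + 1) * p ^ expo p"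
    unfolding q_def using p
    by (metis add.commute dividend_less_times_div mult.commute mult_Suc plus_1_eq_Suc)
  then have "real (x * geom_sum p (expo p)) \<le> real ((q + 1) * p ^ expo p)"
    by (simp only: of_nat_le_iff less_imp_le)
  then have "real x * ?r p \<le> real (q + 1)"
    using p by (simp add: ratio_def field_simps)
  moreover have "0 \<le> prod_list (map ?r ps)"
    using ratio_pos by (intro prod_list_nonneg) (auto simp: ratio_def)
  ultimately have "real x * ?r p * prod_list (map ?r ps) \<le> real (q + 1) * prod_list (map ?r ps)"
    by (intro mult_right_mono)
  also have "\<dots> \<le> real (mult_ratios ps (q + 1))"
    using Cons.prems by (intro Cons.IH) simp
  finally show ?case by (simp add: q_def mult_ac)
qed simp

lemma prod_ratio_le: "(\<Prod>p\<in>set odd_primes. ratio p (expo p)) \<le> 5.697"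
proof -
  \<comment> \<open>The fixed-point scale is 10^7, so the computed value 56970000 stands for
    5.697.\<close>
  have "real (10 ^ 7) * (\<Prod>p\<in>set odd_primes. ratio p (expo p))
      \<le> real (mult_ratios odd_primes (10 ^ 7))"
    unfolding prod_odd_primes by (rule mult_ratios_ge) (auto simp: set_odd_primes)
  also have "mult_ratios odd_primes (10 ^ 7) \<le> 56970000"
    unfolding odd_primes_eq by (simp add: expo_def)
  finally show ?thesis by simp
qed

lemma sigma_le_5_697:
  assumes "odd m" "m < oddPrimeProduct\<^sup>2"
  shows "real (sigma m) \<le> 5.697 * real m"
proof -
  have m: "m > 0" using assms(1) by (auto intro!: gr0I)
  have pf: "prime p \<and> 3 \<le> p" if "p \<in> set odd_primes \<union> prime_factors m" for p
  proof -
    have "3 \<le> p" if "prime p" "p dvd m"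
    proof -
      have "p \<noteq> 2" using that(2) assms(1) by auto
      then show ?thesis using prime_ge_2_nat[OF that(1)] by simp
    qed
    then show ?thesis using that by (auto simp: set_odd_primes in_prime_factors_iff)
  qed
  have "real (sigma m) \<le> real m * (\<Prod>p\<in>set odd_primes. ratio p (expo p))"
  proof (rule sigma_le_of_tangent[where lam = "lagrange 607"])
    fix p a assume "p \<in> set odd_primes \<union> prime_factors m"
    then have p: "prime p" "3 \<le> p" using pf by auto
    then show "ln (ratio p a) \<le>
        ln (ratio p (expo p)) + (real a - real (expo p)) * (lagrange 607 * ln (real p))"
      using lagrange_expo[OF p] by (intro ln_ratio_le_tangent) auto
  next
    fix p assume "p \<in> prime_factors m - set odd_primes"
    then have "\<not> p \<le> 607" using pf[of p] unfolding set_odd_primes by blast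
    then show "expo p = 0" by (simp add: expo_def)
  next
    show "m \<le> (\<Prod>p\<in>set odd_primes. p ^ expo p)"
      using assms(2) oddPrimeProduct_squared_le by linarith
  qed (use m pf lagrange_nonneg in auto)
  also have "\<dots> \<le> real m * 5.697"
    using prod_ratio_le by (intro mult_left_mono) auto
  finally show ?thesis by simp
qed

section \<open>The criteria of Robin and Lagarias\<close>

text \<open>The sequence H_n - ln n decreases to its limit \<gamma>.\<close>

lemma harm_ge_ln_plus_euler_mascheroni:
  assumes "n > 0"
  shows "ln (real n) + euler_mascheroni \<le> harm n"
proof -
  have "euler_mascheroni \<le> harm n - ln (real n)"
    using assms euler_mascheroni_sequence_decreasing
    by (intro LIMSEQ_le_const2[OF euler_mascheroni_LIMSEQ]) blast
  then show ?thesis by simp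
qed

lemma lagarias_of_robin:
  assumes "robin_criterion n" "n \<ge> 3"
  shows "lagarias_criterion n"
proof -
  let ?h = "harm n :: real"
  have h: "ln n + euler_mascheroni \<le> ?h"
    using assms by (intro harm_ge_ln_plus_euler_mascheroni) simp
  have "exp 1 \<le> real n" using e_less_272 assms(2) by simp
  \<comment> \<open>This makes ln (ln n) nonnegative, as multiplying the two bounds below
    requires.\<close>
  then have ln: "1 \<le> ln (real n)" using assms(2) by (subst ln_ge_iff) auto
  have "exp euler_mascheroni * real n = exp (ln n + euler_mascheroni)"
    using assms(2) by (simp add: exp_add)
  also have "\<dots> \<le> exp ?h" using h by simp
  finally have "exp euler_mascheroni * real n \<le> exp ?h" .
  moreover have "ln (ln (real n)) \<le> ln ?h"
    using h ln euler_mascheroni_pos by (intro ln_mono) linarith+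
  ultimately have "exp euler_mascheroni * real n * ln (ln (real n)) \<le> exp ?h * ln ?h"
    using ln by (intro mult_mono) auto
  moreover have "0 \<le> ?h" by (simp add: harm_nonneg)
  ultimately show ?thesis
    using assms(1) unfolding robin_criterion_def lagarias_criterion_def by linarith
qed

lemma exp_euler_mascheroni_ge: "1.778 \<le> exp (euler_mascheroni :: real)"
proof -
  \<comment> \<open>The fraction 19/33 is a known lower bound for \<gamma>.\<close>
  have "ln (1.778::real) \<le> 19/33"
    using ln_approx_bounds[of "1.778" 4] by (simp add: eval_nat_numeral)
  then have "ln (1.778::real) \<le> euler_mascheroni"
    using euler_mascheroni_gt_19_over_33 by linarith
  then have "exp (ln (1.778::real)) \<le> exp euler_mascheroni"
    by (simp only: exp_le_cancel_iff)
  then show ?thesis by simp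
qed

lemma ln_610_ge: "6.41 \<le> ln (610::real)"
proof -
  \<comment> \<open>Splitting off 2^9 leaves an argument near 1, where a short series is accurate
    enough.\<close>
  have "ln (610::real) = ln (2 ^ 9 * (305/256))" by simp
  also have "\<dots> = 9 * ln 2 + ln (305/256)"
    by (subst ln_mult_pos) (simp_all only: ln_realpow, simp_all)
  finally show ?thesis
    using ln_approx_bounds[of 2 3] ln_approx_bounds[of "305/256" 1] by (simp add: eval_nat_numeral)
qed

lemma ln_ln_ge_6_41:
  assumes "2 ^ 881 \<le> n"
  shows "6.41 \<le> ln (ln (real n))"
proof -
  have "real (2 ^ 881) \<le> real n" using assms by (simp only: of_nat_le_iff)
  then have "ln ((2::real) ^ 881) \<le> ln (real n)" by (intro ln_mono) auto
  then have "881 * ln 2 \<le> ln (real n)" by (simp only: ln_realpow of_nat_numeral)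
  \<comment> \<open>This is precise enough: 881 * 307 / 443 exceeds 610.\<close>
  moreover have "307 / 443 \<le> ln (2::real)"
    using ln_approx_bounds[of 2 3] by (simp add: eval_nat_numeral)
  ultimately have "610 \<le> ln (real n)" by simp
  then have "ln 610 \<le> ln (ln (real n))" by (intro ln_mono) auto
  then show ?thesis using ln_610_ge by linarith
qed

lemma sigma_power_2_less: "sigma (2 ^ k) < 2 * 2 ^ k"
proof -
  have "geom_sum 2 k < 2 * 2 ^ k" by (induction k) (simp_all add: geom_sum_Suc)
  then show ?thesis by (simp add: sigma_prime_power)
qed

theorem theorem4:
  fixes m \<alpha> n :: nat
  assumes "odd m" and "1 \<le> m" and "m < oddPrimeProduct ^ 2"
    and "1 \<le> \<alpha>" and "n = 2 ^ \<alpha> * m" and "2 * oddPrimeProduct ^ 2 \<le> n"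
  shows "lagarias_criterion n \<and> robin_criterion n"
proof -
  have "2 ^ 881 = 2 * (2 ^ 440 :: nat)\<^sup>2" by (simp only: power_mult [symmetric] power_Suc [symmetric]) simp
  also have "\<dots> \<le> 2 * oddPrimeProduct\<^sup>2"
    using oddPrimeProduct_bounds(1) by (intro mult_left_mono power_mono) auto
  finally have n_ge: "2 ^ 881 \<le> n" using assms(6) by linarith
  then have lnln: "6.41 \<le> ln (ln (real n))" by (rule ln_ln_ge_6_41)
  have "(2::nat) ^ 2 \<le> 2 ^ 881" by (intro power_increasing) auto
  then have n: "3 \<le> n" using n_ge by simp
  have "sigma n \<le> sigma (2 ^ \<alpha>) * sigma m"
    using assms by (auto intro: sigma_mult_le)
  also have "\<dots> \<le> (2 * 2 ^ \<alpha>) * sigma m"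
    using sigma_power_2_less[of \<alpha>] by (intro mult_right_mono) auto
  finally have "real (sigma n) \<le> real ((2 * 2 ^ \<alpha>) * sigma m)" by (simp only: of_nat_le_iff)
  also have "\<dots> = (2 * 2 ^ \<alpha>) * real (sigma m)" by simp
  also have "\<dots> \<le> (2 * 2 ^ \<alpha>) * (5.697 * real m)"
    using sigma_le_5_697[OF assms(1,3)] by (intro mult_left_mono) auto
  also have "\<dots> = real n * 11.394" using assms(5) by simp
  \<comment> \<open>The strictness of Robin's inequality comes from 11.394 < 11.39698.\<close>
  also have "\<dots> < real n * (1.778 * 6.41)" using n by simp
  also have "\<dots> \<le> real n * (exp euler_mascheroni * ln (ln (real n)))"
    using exp_euler_mascheroni_ge lnln by (intro mult_left_mono mult_mono) auto
  finally have "robin_criterion n" by (simp add: robin_criterion_def mult_ac)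
  then show ?thesis using lagarias_of_robin n by blast
qed

end
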